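(* Let $\omega_0>0$, $k_P>0$ and $v=(1+\epsilon)\mathbf{e}_1\in\mathbb{R}^2$. Consider the planar steering-controlled vehicle $$\tfrac{d}{dt}Q=Q\,Q_{\frac{\pi}{2}}\,\omega,\qquad \tfrac{d}{dt}p=Q\,v,$$ with position $p(t)\in\mathbb{R}^2$, orientation given by a $2\times2$ rotation matrix $Q(t)$, and steering control $\omega=\omega_0+\omega_P$, where $$\omega_P=k_P\,\mathbf{e}_1^T\left(\omega_0\,Q^T(p-p_r)-Q^TQ_r\,Q_{\frac{\pi}{2}}\mathbf{e}_1\right)$$ and the reference $(p_r(t),Q_r(t))$ satisfies $\tfrac{d}{dt}Q_r=Q_rQ_{\frac{\pi}{2}}\omega_0$, $\tfrac{d}{dt}p_r=Q_r\mathbf{e}_1$. Then the vehicle will converge towards motion tracking of the reference. That is, it will rotate at rate $\omega_0$ on a circle of center $c_r$, but of radius $|v|/\omega_0$ possibly different from the reference radius.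
   Context: $\mathbf{e}_1=[1,0]^T$; $Q_{\frac{\pi}{2}}$ is the $2\times2$ matrix of rotation by $\pi/2$ in the plane. The velocity $v$ is a fixed vector, expressed in body frame; its nominal value is $v_r=\mathbf{e}_1$, and here $v$ may differ from $v_r$ by a magnitude bias $\epsilon$ while still being parallel to it. The reference moves at rate $\omega_0$ on a circle of radius $1/\omega_0$ with constant center $c_r=p_r(t)+\tfrac{1}{\omega_0}Q_{\frac{\pi}{2}}Q_r(t)\mathbf{e}_1$. Definition (motion tracking): the vehicle follows the reference motion if and only if, in a frame that moves and turns with the reference, the position and orientation of the controlled vehicle are constant, i.e. $Q_r^T(p-p_r)$ and $Q_r^TQ$ are constant in time; in other words, the reference and the vehicle together form a virtual rigid body, of unimposed shape.
   Formalization: The formal statement assumes 1+ε>0; for 1+ε=0 the vehicle cannot move towards c_r, and for 1+ε<0 the circular motion about c_r is unstable, so the claim fails there. *)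

theory Defs
  imports "HOL-Analysis.Analysis"
begin

definition e1 :: "real ^ 2" where
  "e1 = vector [1, 0]"

definition plane_rotation :: "real \<Rightarrow> real ^ 2 ^ 2" where
  "plane_rotation \<theta> = vector [vector [cos \<theta>, - sin \<theta>], vector [sin \<theta>, cos \<theta>]]"

abbreviation Q_half_pi :: "real ^ 2 ^ 2" where
  "Q_half_pi \<equiv> plane_rotation (pi / 2)"

text \<open>Motions are considered for times $t \ge 0$, with a one-sided derivative at $t = 0$.
  Outside this range the functions are irrelevant.\<close>

definition vehicle_motion ::
    "real ^ 2 \<Rightarrow> (real \<Rightarrow> real) \<Rightarrow> (real \<Rightarrow> real ^ 2) \<Rightarrow> (real \<Rightarrow> real ^ 2 ^ 2) \<Rightarrow> bool" where
  "vehicle_motion v \<omega> p Q \<longleftrightarrow>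
     (\<forall>t\<ge>0. rotation_matrix (Q t) \<and>
        (Q has_vector_derivative \<omega> t *\<^sub>R (Q t ** Q_half_pi)) (at t within {0..}) \<and>
        (p has_vector_derivative Q t *v v) (at t within {0..}))"

definition omega_P ::
    "real \<Rightarrow> real \<Rightarrow> real ^ 2 \<Rightarrow> real ^ 2 ^ 2 \<Rightarrow> real ^ 2 \<Rightarrow> real ^ 2 ^ 2 \<Rightarrow> real" where
  "omega_P \<omega>\<^sub>0 k\<^sub>P p\<^sub>r Q\<^sub>r p Q =
     k\<^sub>P * (e1 \<bullet> (\<omega>\<^sub>0 *\<^sub>R (transpose Q *v (p - p\<^sub>r)) - (transpose Q ** Q\<^sub>r ** Q_half_pi) *v e1))"

definition reference_center :: "real \<Rightarrow> real ^ 2 \<Rightarrow> real ^ 2 ^ 2 \<Rightarrow> real ^ 2" where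
  "reference_center \<omega>\<^sub>0 p\<^sub>r Q\<^sub>r = p\<^sub>r + (1 / \<omega>\<^sub>0) *\<^sub>R ((Q_half_pi ** Q\<^sub>r) *v e1)"

definition motion_tracking ::
    "(real \<Rightarrow> real ^ 2) \<Rightarrow> (real \<Rightarrow> real ^ 2 ^ 2) \<Rightarrow> (real \<Rightarrow> real ^ 2) \<Rightarrow> (real \<Rightarrow> real ^ 2 ^ 2) \<Rightarrow> bool" where
  "motion_tracking p\<^sub>r Q\<^sub>r p Q \<longleftrightarrow>
     (\<exists>d R. \<forall>t\<ge>0. transpose (Q\<^sub>r t) *v (p t - p\<^sub>r t) = d \<and> transpose (Q\<^sub>r t) ** Q t = R)"

end

theory Submission
  imports Defs
begin

text \<open>Identify the plane with the complex numbers: let $q$ be the orientation, $a = 1 + \epsilon$, and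
  $u = \bar q (p - c_r)$ the position relative to the center in the body frame. The center is constant
  and the control is $\omega = \omega_0 (1 + k_P \,\mathrm{Re}\, u)$, so with $x = \mathrm{Re}\, u$ and
  $s = \mathrm{Im}\, u + a/\omega_0$ the closed loop is $x' = \omega s - a k_P x$, $s' = -\omega x$, and
  $V = x^2 + s^2$ satisfies $V' = -2 a k_P x^2$.
  A cross term $\omega x s$ makes \<open>V\<close> strict, so $x, s \to 0$.
  The heading then converges relative to the reference without any rate of convergence: the equations
  for $s$ and $V$ show that $\arg q - \omega_0 t + k_P s - \frac{k_P \omega_0}{2a} V$ is conserved.\<close>

section \<open>One-sided calculus on the half-line\<close>

text \<open>At interior times the derivative within the half-line is a two-sided one, so the mean
  value theorem applies; the endpoint 0 enters through continuity.\<close>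

lemma antimono_half_line:
  fixes f :: "real \<Rightarrow> real"
  assumes deriv: "\<And>t. t \<ge> 0 \<Longrightarrow> (f has_real_derivative f' t) (at t within {0..})"
    and nonpos: "\<And>t. t \<ge> 0 \<Longrightarrow> f' t \<le> 0"
    and "0 \<le> t"
  shows "f t \<le> f 0"
proof (rule DERIV_nonpos_imp_decreasing_open[OF \<open>0 \<le> t\<close>])
  show "\<exists>y. (f has_real_derivative y) (at u) \<and> y \<le> 0" if "0 < u" "u < t" for u
  proof -
    have "at u within {0..} = at u"
      using that by (intro at_within_interior) auto
    then show ?thesis
      using deriv[of u] nonpos[of u] that by auto
  qed
  have "continuous_on {0..} f"
    by (rule DERIV_continuous_on[of _ _ f']) (use deriv in auto)
  then show "continuous_on {0..t} f"
    by (rule continuous_on_subset) auto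
qed

lemma constant_half_line:
  fixes f :: "real \<Rightarrow> 'a::real_normed_vector"
  assumes "\<And>t. t \<ge> 0 \<Longrightarrow> (f has_vector_derivative 0) (at t within {0..})"
    and "0 \<le> t"
  shows "f t = f 0"
proof -
  have "\<exists>c. \<forall>t\<in>{0..}. f t = c"
    by (rule has_derivative_zero_constant[of "{0..}" f, simplified])
      (use assms in \<open>auto simp: has_vector_derivative_def\<close>)
  then show ?thesis
    using \<open>0 \<le> t\<close> by auto
qed

section \<open>Lyapunov decay in the body frame\<close>

text \<open>The expression being bounded is minus the derivative of the cross term w x s along the
  closed loop. Young's inequality splits the terms of odd degree in w so that together they cost at
  most half of w^2 s^2; all the rest is paid for by a multiple of x^2, which the derivative of V can
  absorb.\<close>

lemma lyapunov_derivative_bound: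
  fixes x s w\<^sub>0 k a V\<^sub>0 w :: real
  assumes "x\<^sup>2 + s\<^sup>2 \<le> V\<^sub>0" "w = w\<^sub>0 + k * w\<^sub>0 * x" "0 < w\<^sub>0" "0 < k" "0 < a"
  defines "C \<equiv> (a * k)\<^sup>2 + 4 * (k * w\<^sub>0)\<^sup>2 * V\<^sub>0 + 2 * w\<^sub>0\<^sup>2 + a * k * (k * w\<^sub>0) * (1 + V\<^sub>0)"
  shows "a * k * w * x * s + w\<^sup>2 * x\<^sup>2 - k * w\<^sub>0 * w * x * s\<^sup>2 + a * k * (k * w\<^sub>0) * x\<^sup>2 * s - w\<^sup>2 * s\<^sup>2
          \<le> C * x\<^sup>2 - w\<^sub>0\<^sup>2 / 4 * s\<^sup>2"
proof -
  define b A where "b = k * w\<^sub>0" and "A = a * k"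
  have pos: "b > 0" "A > 0" and w: "w = w\<^sub>0 + b * x"
    using assms by (auto simp: b_def A_def)
  have x2: "x\<^sup>2 \<le> V\<^sub>0" and s2: "s\<^sup>2 \<le> V\<^sub>0"
    using assms(1) zero_le_power2[of s] zero_le_power2[of x] by linarith+
  have 1: "A * w * x * s \<le> w\<^sup>2 * s\<^sup>2 / 4 + A\<^sup>2 * x\<^sup>2"
    using zero_le_power2[of "w * s / 2 - A * x"]
    by (simp add: power2_eq_square algebra_simps)
  have "- (b * w * x * s\<^sup>2) \<le> w\<^sup>2 * s\<^sup>2 / 4 + b\<^sup>2 * x\<^sup>2 * s\<^sup>2"
    using zero_le_power2[of "w * s / 2 + b * x * s"]
    by (simp add: power2_eq_square algebra_simps)
  moreover have "b\<^sup>2 * x\<^sup>2 * s\<^sup>2 \<le> b\<^sup>2 * x\<^sup>2 * V\<^sub>0"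
    using s2 by (intro mult_left_mono) auto
  ultimately have 2: "- (b * w * x * s\<^sup>2) \<le> w\<^sup>2 * s\<^sup>2 / 4 + b\<^sup>2 * x\<^sup>2 * V\<^sub>0"
    by linarith
  have bx: "b\<^sup>2 * x\<^sup>2 \<le> b\<^sup>2 * V\<^sub>0"
    using x2 by (intro mult_left_mono) auto
  have "w\<^sup>2 \<le> 2 * w\<^sub>0\<^sup>2 + 2 * (b\<^sup>2 * x\<^sup>2)"
    using zero_le_power2[of "w\<^sub>0 - b * x"] unfolding w
    by (simp add: power2_eq_square algebra_simps)
  then have "w\<^sup>2 \<le> 2 * w\<^sub>0\<^sup>2 + 2 * (b\<^sup>2 * V\<^sub>0)"
    using bx by linarith
  then have 3: "w\<^sup>2 * x\<^sup>2 \<le> (2 * w\<^sub>0\<^sup>2 + 2 * (b\<^sup>2 * V\<^sub>0)) * x\<^sup>2"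
    by (intro mult_right_mono) auto
  \<comment> \<open>From 2 s \<le> s^2 + 1; this polynomial bound keeps square roots out of
    \<open>C\<close>.\<close>
  have "s \<le> 1 + V\<^sub>0"
    using s2 zero_le_power2[of "s - 1"] zero_le_power2[of s]
    unfolding power2_diff power_one mult_1_right
    by linarith
  then have 4: "A * b * x\<^sup>2 * s \<le> A * b * x\<^sup>2 * (1 + V\<^sub>0)"
    using pos by (intro mult_left_mono) auto
  \<comment> \<open>The rate w may vanish, so w^2 s^2 does not dominate s^2 by itself. As
    \<open>w\<^sub>0\<close> = w - b x, the loss is of order x^2 s^2 and goes into the x^2
    term.\<close>
  have "w\<^sub>0\<^sup>2 \<le> 2 * w\<^sup>2 + 2 * (b\<^sup>2 * x\<^sup>2)"
    using zero_le_power2[of "w + b * x"] unfolding w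
    by (simp add: power2_eq_square algebra_simps)
  then have "w\<^sub>0\<^sup>2 * s\<^sup>2 \<le> (2 * w\<^sup>2 + 2 * (b\<^sup>2 * x\<^sup>2)) * s\<^sup>2"
    by (intro mult_right_mono) auto
  moreover have "b\<^sup>2 * x\<^sup>2 * s\<^sup>2 \<le> b\<^sup>2 * x\<^sup>2 * V\<^sub>0"
    using s2 by (intro mult_left_mono) auto
  ultimately have 5: "w\<^sub>0\<^sup>2 * s\<^sup>2 \<le> 2 * (w\<^sup>2 * s\<^sup>2) + 2 * (b\<^sup>2 * x\<^sup>2 * V\<^sub>0)"
    by (simp add: algebra_simps)
  have "A * w * x * s + w\<^sup>2 * x\<^sup>2 - b * w * x * s\<^sup>2 + A * b * x\<^sup>2 * s - w\<^sup>2 * s\<^sup>2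
      \<le> A\<^sup>2 * x\<^sup>2 + b\<^sup>2 * x\<^sup>2 * V\<^sub>0 + (2 * w\<^sub>0\<^sup>2 + 2 * (b\<^sup>2 * V\<^sub>0)) * x\<^sup>2
        + A * b * x\<^sup>2 * (1 + V\<^sub>0) + b\<^sup>2 * x\<^sup>2 * V\<^sub>0 / 2 - w\<^sub>0\<^sup>2 * s\<^sup>2 / 4"
    using 1 2 3 4 5 by linarith
  \<comment> \<open>The contributions of b^2 \<open>V\<^sub>0\<close> add up to 7/2, which
    \<open>C\<close> rounds up to 4; the surplus is the last summand.\<close>
  also have "\<dots> = C * x\<^sup>2 - w\<^sub>0\<^sup>2 / 4 * s\<^sup>2 - b\<^sup>2 * x\<^sup>2 * V\<^sub>0 / 2"
    unfolding C_def b_def[symmetric] A_def[symmetric] by (simp add: algebra_simps)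
  also have "\<dots> \<le> C * x\<^sup>2 - w\<^sub>0\<^sup>2 / 4 * s\<^sup>2"
    using order.trans[OF zero_le_power2 x2] by simp
  finally show ?thesis
    unfolding b_def A_def .
qed

text \<open>The derivative of \<open>V\<close> controls only $x$. The cross term \<open>W\<^sub>0\<close> $= w x s$ has a derivative
  containing $w^2 s^2$, so for large \<open>K\<close> the function $K V - w x s$ decreases at least at the rate
  $(w_0^2/4) V$; as \<open>V\<close> itself decreases, this gives $V = O(1/t)$.\<close>

lemma body_frame_convergence:
  fixes x s w :: "real \<Rightarrow> real" and w\<^sub>0 k a :: real
  assumes pos: "0 < w\<^sub>0" "0 < k" "0 < a"
    and w: "\<And>t. 0 \<le> t \<Longrightarrow> w t = w\<^sub>0 + k * w\<^sub>0 * x t"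
    and dx: "\<And>t. 0 \<le> t \<Longrightarrow> (x has_real_derivative w t * s t - a * k * x t) (at t within {0..})"
    and ds: "\<And>t. 0 \<le> t \<Longrightarrow> (s has_real_derivative - w t * x t) (at t within {0..})"
  shows "(x \<longlongrightarrow> 0) at_top" and "(s \<longlongrightarrow> 0) at_top"
proof -
  define V where "V t = (x t)\<^sup>2 + (s t)\<^sup>2" for t
  \<comment> \<open>The rate is written out in terms of \<open>x\<close>, because the derivative of
    the cross term comes from those of \<open>x\<close> and \<open>s\<close>.\<close>
  define W\<^sub>0 where "W\<^sub>0 t = (w\<^sub>0 + k * w\<^sub>0 * x t) * x t * s t" for t
  define C where "C = (a * k)\<^sup>2 + 4 * (k * w\<^sub>0)\<^sup>2 * V 0 + 2 * w\<^sub>0\<^sup>2 + a * k * (k * w\<^sub>0) * (1 + V 0)"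
  \<comment> \<open>Chosen so that 2 a k K x^2 absorbs C x^2 and also supplies the x^2 part of
    (\<open>w\<^sub>0\<close>^2 / 4) V; the s^2 part comes from the cross term.\<close>
  define K where "K = (C + w\<^sub>0\<^sup>2 / 4) / (2 * a * k)"
  \<comment> \<open>The derivative of t V is V + t V' with V' \<le> 0, so adding this weighted term
    keeps the sum nonincreasing. Its boundedness is what yields the 1/t decay.\<close>
  define f where "f t = K * V t - W\<^sub>0 t + w\<^sub>0\<^sup>2 / 4 * t * V t" for t
  have V_nonneg: "0 \<le> V t" for t
    by (simp add: V_def)
  have dV: "(V has_real_derivative - 2 * a * k * (x t)\<^sup>2) (at t within {0..})" if "0 \<le> t" for t
    unfolding V_def
    by (rule derivative_eq_intros dx[OF that] ds[OF that] refl)+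
      (simp add: power2_eq_square algebra_simps)
  have V_le: "V t \<le> V 0" if "0 \<le> t" for t
    by (rule antimono_half_line[OF dV _ that]) (use pos in auto)
  have K: "K \<ge> 0" and aK: "2 * a * k * K = C + w\<^sub>0\<^sup>2 / 4"
    using pos V_nonneg[of 0] by (auto simp: K_def C_def)
  define N where "N t = a * k * w t * x t * s t + (w t)\<^sup>2 * (x t)\<^sup>2 - k * w\<^sub>0 * w t * x t * (s t)\<^sup>2
    + a * k * (k * w\<^sub>0) * (x t)\<^sup>2 * s t - (w t)\<^sup>2 * (s t)\<^sup>2" for t
  have dW: "(W\<^sub>0 has_real_derivative - N t) (at t within {0..})" if "0 \<le> t" for t
    unfolding W\<^sub>0_def N_def
    by (rule derivative_eq_intros dx[OF that] ds[OF that] refl)+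
      (simp add: w[OF that] power2_eq_square algebra_simps)
  have df: "(f has_real_derivative - 2 * a * k * (x t)\<^sup>2 * (K + w\<^sub>0\<^sup>2 / 4 * t) + N t + w\<^sub>0\<^sup>2 / 4 * V t)
      (at t within {0..})" if "0 \<le> t" for t
    unfolding f_def
    by (rule derivative_eq_intros dV[OF that] dW[OF that] refl)+ (simp add: algebra_simps)
  have df_nonpos: "- 2 * a * k * (x t)\<^sup>2 * (K + w\<^sub>0\<^sup>2 / 4 * t) + N t + w\<^sub>0\<^sup>2 / 4 * V t \<le> 0"
    if "0 \<le> t" for t
  proof -
    have "N t \<le> C * (x t)\<^sup>2 - w\<^sub>0\<^sup>2 / 4 * (s t)\<^sup>2"
      unfolding N_def C_def
      by (rule lyapunov_derivative_bound) (use V_le[OF that] w[OF that] pos in \<open>auto simp: V_def\<close>)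
    moreover have "0 \<le> 2 * a * k * (x t)\<^sup>2 * (w\<^sub>0\<^sup>2 / 4 * t)"
      using pos that by simp
    moreover have "2 * a * k * (x t)\<^sup>2 * K = C * (x t)\<^sup>2 + w\<^sub>0\<^sup>2 / 4 * (x t)\<^sup>2"
      using arg_cong[OF aK, of "\<lambda>y. y * (x t)\<^sup>2"] by (simp add: algebra_simps)
    ultimately show ?thesis
      by (simp add: V_def algebra_simps)
  qed
  have f_le: "f t \<le> f 0" if "0 \<le> t" for t
    by (rule antimono_half_line[OF df df_nonpos that])
  \<comment> \<open>The initial value of \<open>f\<close> plus a bound for the cross term, from |x|
    \<le> 1 + V 0 and |x s| \<le> V 0.\<close>
  define B where "B = f 0 + (w\<^sub>0 + k * w\<^sub>0 * (1 + V 0)) * V 0"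
  have V_decay: "V t \<le> 4 * B / w\<^sub>0\<^sup>2 / t" if "0 < t" for t
  proof -
    have t: "0 \<le> t"
      using that by simp
    have xs: "\<bar>x t * s t\<bar> \<le> V 0"
      using V_le[OF t] zero_le_power2[of "\<bar>x t\<bar> - \<bar>s t\<bar>"] zero_le_power2[of "x t"] zero_le_power2[of "s t"]
      unfolding V_def power2_diff abs_mult power2_abs mult.assoc by linarith
    have "\<bar>x t\<bar> \<le> 1 + V 0"
      using V_le[OF t] zero_le_power2[of "\<bar>x t\<bar> - 1"] zero_le_power2[of "x t"] zero_le_power2[of "s t"]
      unfolding V_def power2_diff power2_abs power_one mult_1_right by linarith
    then have "\<bar>w\<^sub>0 + k * w\<^sub>0 * x t\<bar> \<le> w\<^sub>0 + k * w\<^sub>0 * (1 + V 0)"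
      using pos by (intro order.trans[OF abs_triangle_ineq]) (simp add: abs_mult)
    then have "\<bar>W\<^sub>0 t\<bar> \<le> (w\<^sub>0 + k * w\<^sub>0 * (1 + V 0)) * V 0"
      unfolding W\<^sub>0_def mult.assoc abs_mult[of "w\<^sub>0 + _"] using xs
      by (intro mult_mono) auto
    moreover have "0 \<le> K * V t"
      using K V_nonneg by simp
    ultimately have "w\<^sub>0\<^sup>2 / 4 * t * V t \<le> B"
      using f_le[OF t] unfolding f_def[of t] B_def by linarith
    then show ?thesis
      using that pos by (simp add: field_simps)
  qed
  have "((\<lambda>t. 4 * B / w\<^sub>0\<^sup>2 / t) \<longlongrightarrow> 0) at_top"
    by (intro tendsto_divide_0[OF tendsto_const] filterlim_at_top_imp_at_infinity filterlim_ident)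
  then have V: "(V \<longlongrightarrow> 0) at_top"
    by (rule tendsto_sandwich[OF always_eventually eventually_mono[OF eventually_gt_at_top[of 0]] tendsto_const,
          rotated 2])
      (use V_decay V_nonneg in auto)
  from tendsto_real_sqrt[OF this] have rV: "((\<lambda>t. sqrt (V t)) \<longlongrightarrow> 0) at_top"
    by simp
  show "(x \<longlongrightarrow> 0) at_top" "(s \<longlongrightarrow> 0) at_top"
    by (rule Lim_null_comparison[OF always_eventually rV], simp add: V_def)+
qed

section \<open>Convergence of heading and position in complex form\<close>

text \<open>Here \<open>d\<close> is the position relative to the fixed center. The limit is the
  uniform rotation with body-frame position -i a / \<open>w\<^sub>0\<close>, the equilibrium of the
  closed loop; its phase \<open>g\<close> depends on the initial state and is read off from the
  conserved quantity.\<close>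

lemma steering_convergence:
  fixes q d :: "real \<Rightarrow> complex" and w :: "real \<Rightarrow> real" and w\<^sub>0 k a :: real
  assumes pos: "0 < w\<^sub>0" "0 < k" "0 < a"
    and norm_q: "\<And>t. 0 \<le> t \<Longrightarrow> norm (q t) = 1"
    and dq: "\<And>t. 0 \<le> t \<Longrightarrow> (q has_vector_derivative w t *\<^sub>R (q t * \<i>)) (at t within {0..})"
    and dd: "\<And>t. 0 \<le> t \<Longrightarrow> (d has_vector_derivative q t * of_real a) (at t within {0..})"
    and w: "\<And>t. 0 \<le> t \<Longrightarrow> w t = w\<^sub>0 + k * w\<^sub>0 * Re (cnj (q t) * d t)"
  obtains g where "norm g = 1"
    and "((\<lambda>t. q t - g * cis (w\<^sub>0 * t)) \<longlongrightarrow> 0) at_top"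
    and "((\<lambda>t. d t - g * cis (w\<^sub>0 * t) * (- \<i> * of_real (a / w\<^sub>0))) \<longlongrightarrow> 0) at_top"
    and "(w \<longlongrightarrow> w\<^sub>0) at_top"
proof -
  define u where "u t = cnj (q t) * d t" for t
  define x where "x t = Re (u t)" for t
  \<comment> \<open>The shift moves the equilibrium to the origin: in the equation for x the
    constant a combines with -w a / \<open>w\<^sub>0\<close> to the damping term -a k x.\<close>
  define s where "s t = Im (u t) + a / w\<^sub>0" for t
  have w_x: "w t = w\<^sub>0 + k * w\<^sub>0 * x t" if "0 \<le> t" for t
    using w[OF that] by (simp add: x_def u_def)
  have q_cnj: "q t * cnj (q t) = 1" if "0 \<le> t" for t
    using norm_q[OF that] by (simp add: complex_norm_square[symmetric])
  have du: "(u has_vector_derivative of_real a - \<i> * of_real (w t) * u t) (at t within {0..})"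
    if "0 \<le> t" for t
  proof -
    have "(u has_vector_derivative cnj (q t) * (q t * of_real a) + cnj (w t *\<^sub>R (q t * \<i>)) * d t)
        (at t within {0..})"
      unfolding u_def
      by (intro has_vector_derivative_mult dd[OF that]
          bounded_linear.has_vector_derivative[OF bounded_linear_cnj dq[OF that]])
    also have "cnj (q t) * (q t * of_real a) = of_real a"
      using q_cnj[OF that] by (simp add: ac_simps)
    finally show ?thesis
      by (simp add: u_def[abs_def] scaleR_conv_of_real algebra_simps)
  qed
  have dx: "(x has_real_derivative w t * s t - a * k * x t) (at t within {0..})" if "0 \<le> t" for t
  proof -
    have "Re (of_real a - \<i> * of_real (w t) * u t) = w t * s t - a * k * x t"
      using pos by (simp add: x_def s_def w_x[OF that] field_simps)
    then show ?thesis
      using bounded_linear.has_vector_derivative[OF bounded_linear_Re du[OF that]]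
      by (simp add: x_def[abs_def] has_real_derivative_iff_has_vector_derivative)
  qed
  have ds: "(s has_real_derivative - w t * x t) (at t within {0..})" if "0 \<le> t" for t
  proof -
    have "((\<lambda>t. Im (u t)) has_real_derivative - w t * x t) (at t within {0..})"
      using bounded_linear.has_vector_derivative[OF bounded_linear_Im du[OF that]]
      by (simp add: x_def has_real_derivative_iff_has_vector_derivative)
    from DERIV_add[OF this DERIV_const] show ?thesis
      by (simp add: s_def[abs_def])
  qed
  have x0: "(x \<longlongrightarrow> 0) at_top" and s0: "(s \<longlongrightarrow> 0) at_top"
    by (rule body_frame_convergence[OF pos w_x dx ds]; assumption)+

  \<comment> \<open>With \<open>q = exp (i \<theta>)\<close>, the quantity \<open>\<theta> - w\<^sub>0 t + \<psi>\<close> is conserved, and \<open>\<psi> \<rightarrow> 0\<close>.\<close>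
  define \<psi> where "\<psi> t = k * s t - k * w\<^sub>0 / (2 * a) * ((x t)\<^sup>2 + (s t)\<^sup>2)" for t
  define g where "g = q 0 * cis (\<psi> 0)"
  \<comment> \<open>The V term cancels the quadratic part of k s', leaving \<psi>' = -k
    \<open>w\<^sub>0\<close> x = \<open>w\<^sub>0\<close> - w.\<close>
  have d\<psi>: "((\<lambda>t. \<psi> t - w\<^sub>0 * t) has_real_derivative - w t) (at t within {0..})" if "0 \<le> t" for t
    unfolding \<psi>_def
    by (rule derivative_eq_intros dx[OF that] ds[OF that] refl)+
      (use pos in \<open>simp add: w_x[OF that] field_simps power2_eq_square\<close>)
  \<comment> \<open>The conservation law in exponentiated form, which avoids choosing a continuous
    argument of \<open>q\<close>.\<close>
  have G: "q t * cis (\<psi> t - w\<^sub>0 * t) = g" if "0 \<le> t" for t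
  proof -
    have "((\<lambda>t. q t * cis (\<psi> t - w\<^sub>0 * t)) has_vector_derivative 0) (at t within {0..})"
      if "0 \<le> t" for t
    proof -
      have "((\<lambda>t. cis (\<psi> t - w\<^sub>0 * t)) has_vector_derivative
          - w t *\<^sub>R (\<i> * cis (\<psi> t - w\<^sub>0 * t))) (at t within {0..})"
        using has_derivative_cis[OF d\<psi>[OF that, unfolded has_field_derivative_def]]
        by (simp add: has_vector_derivative_def mult.commute)
      from has_vector_derivative_mult[OF dq[OF that] this] show ?thesis
        by (simp add: algebra_simps)
    qed
    from constant_half_line[OF this that] show ?thesis
      by (simp add: g_def)
  qed
  have q_eq: "q t = g * cis (w\<^sub>0 * t) * cis (- \<psi> t)" if "0 \<le> t" for t
    unfolding G[OF that, symmetric] by (simp add: mult.assoc cis_mult)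
  have norm_g: "norm g = 1"
    using norm_q[of 0] by (simp add: g_def norm_mult)
  have "(\<psi> \<longlongrightarrow> k * 0 - k * w\<^sub>0 / (2 * a) * (0\<^sup>2 + 0\<^sup>2)) at_top"
    unfolding \<psi>_def by (intro tendsto_intros x0 s0)
  then have "((\<lambda>t. cis (- \<psi> t)) \<longlongrightarrow> cis (- (k * 0 - k * w\<^sub>0 / (2 * a) * (0\<^sup>2 + 0\<^sup>2)))) at_top"
    by (rule continuous_on_tendsto_compose[OF continuous_on_cis[OF continuous_on_minus[OF continuous_on_id[of UNIV]]]])
      auto
  from LIM_zero[OF this] have "((\<lambda>t. cis (- \<psi> t) - 1) \<longlongrightarrow> 0) at_top"
    by simp
  then have "((\<lambda>t. norm (cis (- \<psi> t) - 1)) \<longlongrightarrow> 0) at_top"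
    by (rule tendsto_norm_zero)
  then have q_lim: "((\<lambda>t. q t - g * cis (w\<^sub>0 * t)) \<longlongrightarrow> 0) at_top"
  proof (rule Lim_null_comparison[rotated], intro eventually_mono[OF eventually_ge_at_top[of 0]])
    fix t :: real assume "0 \<le> t"
    then have "q t - g * cis (w\<^sub>0 * t) = g * cis (w\<^sub>0 * t) * (cis (- \<psi> t) - 1)"
      by (simp add: q_eq algebra_simps)
    then show "norm (q t - g * cis (w\<^sub>0 * t)) \<le> norm (cis (- \<psi> t) - 1)"
      by (simp add: norm_mult norm_g)
  qed
  have "((\<lambda>t. norm (Complex (x t) (s t))) \<longlongrightarrow> 0) at_top"
    using tendsto_real_sqrt[OF tendsto_add[OF tendsto_power[OF x0] tendsto_power[OF s0]], of 2 2]
    by (simp add: complex_norm)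
  \<comment> \<open>The position is first compared with the actual heading, where the error is
    \<open>q\<close> times x + i s; the heading is then replaced by its limit.\<close>
  then have "((\<lambda>t. d t - q t * (- \<i> * of_real (a / w\<^sub>0))) \<longlongrightarrow> 0) at_top"
  proof (rule Lim_null_comparison[rotated], intro eventually_mono[OF eventually_ge_at_top[of 0]])
    fix t :: real assume t: "0 \<le> t"
    have "d t = q t * u t"
      using q_cnj[OF t] by (simp add: u_def mult.assoc[symmetric])
    then have "d t - q t * (- \<i> * of_real (a / w\<^sub>0)) = q t * Complex (x t) (s t)"
      by (simp add: complex_eq_iff x_def s_def algebra_simps)
    then show "norm (d t - q t * (- \<i> * of_real (a / w\<^sub>0))) \<le> norm (Complex (x t) (s t))"
      by (simp add: norm_mult norm_q[OF t])
  qed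
  from tendsto_add[OF this tendsto_mult_left_zero[OF q_lim, of "- \<i> * of_real (a / w\<^sub>0)"]]
  have d_lim: "((\<lambda>t. d t - g * cis (w\<^sub>0 * t) * (- \<i> * of_real (a / w\<^sub>0))) \<longlongrightarrow> 0) at_top"
    by (simp add: algebra_simps)
  have "((\<lambda>t. w\<^sub>0 + k * w\<^sub>0 * x t) \<longlongrightarrow> w\<^sub>0) at_top"
    using tendsto_add[OF tendsto_const tendsto_mult_left[OF x0]] by simp
  moreover have "eventually (\<lambda>t. w\<^sub>0 + k * w\<^sub>0 * x t = w t) at_top"
    using eventually_ge_at_top[of 0] by eventually_elim (simp add: w_x)
  ultimately have "(w \<longlongrightarrow> w\<^sub>0) at_top"
    by (rule Lim_transform_eventually)
  with that norm_g q_lim d_lim show ?thesis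
    by blast
qed

section \<open>Complex description of plane vectors and rotations\<close>

text \<open>The plane is identified with the complex numbers, and rotation matrices with complex numbers
  of modulus 1. The map \<open>of_mat\<close> reads off the first column, so it inverts \<open>to_mat\<close> only on
  matrices of the form \<open>to_mat z\<close>.\<close>

definition to_vec :: "complex \<Rightarrow> real ^ 2" where
  "to_vec z = vector [Re z, Im z]"

definition of_vec :: "real ^ 2 \<Rightarrow> complex" where
  "of_vec x = Complex (x $ 1) (x $ 2)"

definition to_mat :: "complex \<Rightarrow> real ^ 2 ^ 2" where
  "to_mat z = vector [vector [Re z, - Im z], vector [Im z, Re z]]"

definition of_mat :: "real ^ 2 ^ 2 \<Rightarrow> complex" where
  "of_mat A = Complex (A $ 1 $ 1) (A $ 2 $ 1)"

lemma bounded_linear_to_vec: "bounded_linear to_vec"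
  by (intro linear_conv_bounded_linear[THEN iffD1] linearI)
    (auto simp: to_vec_def vec_eq_iff forall_2)

lemma bounded_linear_to_mat: "bounded_linear to_mat"
  by (intro linear_conv_bounded_linear[THEN iffD1] linearI)
    (auto simp: to_mat_def vec_eq_iff forall_2)

lemma bounded_linear_of_vec: "bounded_linear of_vec"
  by (intro linear_conv_bounded_linear[THEN iffD1] linearI)
    (auto simp: of_vec_def complex_eq_iff)

lemma bounded_linear_of_mat: "bounded_linear of_mat"
  by (intro linear_conv_bounded_linear[THEN iffD1] linearI)
    (auto simp: of_mat_def complex_eq_iff)

lemma to_vec_of_vec [simp]: "to_vec (of_vec x) = x"
  by (simp add: to_vec_def of_vec_def vec_eq_iff forall_2)

lemma of_vec_to_vec [simp]: "of_vec (to_vec z) = z"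
  by (simp add: to_vec_def of_vec_def)

lemma of_mat_to_mat [simp]: "of_mat (to_mat z) = z"
  by (simp add: to_mat_def of_mat_def)

lemma to_mat_mult: "to_mat z ** to_mat w = to_mat (z * w)"
  by (simp add: to_mat_def matrix_matrix_mult_def vec_eq_iff forall_2 sum_2)

lemma to_mat_vector_mult: "to_mat z *v to_vec w = to_vec (z * w)"
  by (simp add: to_mat_def to_vec_def matrix_vector_mult_def vec_eq_iff forall_2 sum_2)

lemma transpose_to_mat: "transpose (to_mat z) = to_mat (cnj z)"
  by (simp add: to_mat_def transpose_def vec_eq_iff forall_2)

lemma inner_to_vec: "to_vec z \<bullet> to_vec w = Re (cnj z * w)"
  by (simp add: to_vec_def inner_vec_def sum_2)

lemma norm_to_vec: "norm (to_vec z) = norm z"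
  by (simp add: to_vec_def norm_vec_def L2_set_def sum_2 cmod_def)

lemma e1_eq_to_vec: "e1 = to_vec 1"
  by (simp add: e1_def to_vec_def)

lemma Q_half_pi_eq_to_mat: "Q_half_pi = to_mat \<i>"
  by (simp add: plane_rotation_def to_mat_def)

lemma to_vec_add: "to_vec (z + w) = to_vec z + to_vec w"
  and to_vec_diff: "to_vec (z - w) = to_vec z - to_vec w"
  and to_vec_scaleR: "to_vec (r *\<^sub>R z) = r *\<^sub>R to_vec z"
  using bounded_linear_to_vec[THEN bounded_linear.linear]
  by (simp_all add: linear_add linear_diff linear_scale)

lemma rotation_matrix_to_mat:
  assumes "norm z = 1"
  shows "rotation_matrix (to_mat z)"
proof -
  have "(Re z)\<^sup>2 + (Im z)\<^sup>2 = 1"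
    using assms by (simp add: cmod_def)
  then show ?thesis
    by (simp add: rotation_matrix_def orthogonal_matrix transpose_to_mat to_mat_mult)
      (simp add: to_mat_def det_2 mat_def vec_eq_iff forall_2 power2_eq_square)
qed

text \<open>Unit columns and determinant 1 give (a - d)^2 + (b + c)^2 = 1 + 1 - 2 (a d - b c) = 0,
  which forces d = a and b = -c.\<close>

lemma rotation_matrix_eq_to_mat:
  assumes "rotation_matrix A"
  shows "A = to_mat (of_mat A)" and "norm (of_mat A) = 1"
proof -
  define a b c d where "a = A $ 1 $ 1" "b = A $ 1 $ 2" "c = A $ 2 $ 1" "d = A $ 2 $ 2"
  have "transpose A ** A = mat 1"
    using assms by (simp add: rotation_matrix_def orthogonal_matrix)
  then have cols: "a\<^sup>2 + c\<^sup>2 = 1" "b\<^sup>2 + d\<^sup>2 = 1"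
    by (simp_all add: transpose_def matrix_matrix_mult_def mat_def vec_eq_iff forall_2 sum_2
        power2_eq_square a_b_c_d_def)
  moreover have "a * d - b * c = 1"
    using assms by (simp add: rotation_matrix_def det_2 a_b_c_d_def)
  ultimately have "(a - d)\<^sup>2 + (b + c)\<^sup>2 = 0"
    by (simp add: power2_sum power2_diff)
  then have "d = a" "b = - c"
    by simp_all
  then show "A = to_mat (of_mat A)"
    by (simp add: to_mat_def of_mat_def vec_eq_iff forall_2 a_b_c_d_def)
  show "norm (of_mat A) = 1"
    using cols(1) by (simp add: of_mat_def cmod_def a_b_c_d_def)
qed

section \<open>Transfer of the motions and the control law\<close>

text \<open>Derivatives pass through the linear maps \<open>of_mat\<close> and
  \<open>of_vec\<close>. Since \<open>of_mat\<close> is not multiplicative on arbitrary matrices,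
  products are evaluated after \<open>Q t\<close> is rewritten as a \<open>to_mat\<close>.\<close>

lemma vehicle_motion_complexD:
  assumes "vehicle_motion (to_vec v) w p Q" "0 \<le> t"
  shows "Q t = to_mat (of_mat (Q t))" and "norm (of_mat (Q t)) = 1"
    and "((\<lambda>t. of_mat (Q t)) has_vector_derivative w t *\<^sub>R (of_mat (Q t) * \<i>)) (at t within {0..})"
    and "((\<lambda>t. of_vec (p t)) has_vector_derivative of_mat (Q t) * v) (at t within {0..})"
proof -
  have R: "rotation_matrix (Q t)"
    and dQ: "(Q has_vector_derivative w t *\<^sub>R (Q t ** Q_half_pi)) (at t within {0..})"
    and dp: "(p has_vector_derivative Q t *v to_vec v) (at t within {0..})"
    using assms by (auto simp: vehicle_motion_def)
  show Q: "Q t = to_mat (of_mat (Q t))" and "norm (of_mat (Q t)) = 1"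
    using rotation_matrix_eq_to_mat[OF R] .
  have "of_mat (w t *\<^sub>R (Q t ** Q_half_pi)) = w t *\<^sub>R (of_mat (Q t) * \<i>)"
    by (subst Q) (simp add: linear_scale[OF bounded_linear.linear[OF bounded_linear_of_mat]]
        Q_half_pi_eq_to_mat to_mat_mult)
  then show "((\<lambda>t. of_mat (Q t)) has_vector_derivative w t *\<^sub>R (of_mat (Q t) * \<i>)) (at t within {0..})"
    using bounded_linear.has_vector_derivative[OF bounded_linear_of_mat dQ] by simp
  have "of_vec (Q t *v to_vec v) = of_mat (Q t) * v"
    by (subst Q) (simp add: to_mat_vector_mult)
  then show "((\<lambda>t. of_vec (p t)) has_vector_derivative of_mat (Q t) * v) (at t within {0..})"
    using bounded_linear.has_vector_derivative[OF bounded_linear_of_vec dp] by simp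
qed

lemma vehicle_motion_complexI:
  assumes "\<And>t. 0 \<le> t \<Longrightarrow> norm (q t) = 1"
    and "\<And>t. 0 \<le> t \<Longrightarrow> (q has_vector_derivative w t *\<^sub>R (q t * \<i>)) (at t within {0..})"
    and "\<And>t. 0 \<le> t \<Longrightarrow> (p has_vector_derivative q t * v) (at t within {0..})"
  shows "vehicle_motion (to_vec v) w (\<lambda>t. to_vec (p t)) (\<lambda>t. to_mat (q t))"
  using assms(1) bounded_linear.has_vector_derivative[OF bounded_linear_to_mat assms(2)]
    bounded_linear.has_vector_derivative[OF bounded_linear_to_vec assms(3)]
  by (simp add: vehicle_motion_def rotation_matrix_to_mat Q_half_pi_eq_to_mat to_mat_mult
      to_mat_vector_mult linear_scale[OF bounded_linear.linear[OF bounded_linear_to_mat]])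

text \<open>The heading term of the control is \<open>\<omega>\<^sub>0\<close> times the offset from
  the reference position to its center, so the feedback sees the reference only through that
  center.\<close>

lemma omega_P_complex:
  assumes "0 < w\<^sub>0"
  shows "omega_P w\<^sub>0 k p\<^sub>r (to_mat q\<^sub>r) p (to_mat q)
    = k * w\<^sub>0 * Re (cnj q * (of_vec p - (of_vec p\<^sub>r + \<i> * q\<^sub>r / of_real w\<^sub>0)))"
proof -
  have "p - p\<^sub>r = to_vec (of_vec p - of_vec p\<^sub>r)"
    by (simp add: to_vec_diff)
  then have "omega_P w\<^sub>0 k p\<^sub>r (to_mat q\<^sub>r) p (to_mat q)
      = k * Re (w\<^sub>0 *\<^sub>R (cnj q * (of_vec p - of_vec p\<^sub>r)) - cnj q * q\<^sub>r * \<i>)"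
    by (simp add: omega_P_def transpose_to_mat to_mat_mult to_mat_vector_mult e1_eq_to_vec
        Q_half_pi_eq_to_mat inner_to_vec flip: to_vec_scaleR to_vec_diff)
  also have "w\<^sub>0 *\<^sub>R (cnj q * (of_vec p - of_vec p\<^sub>r)) - cnj q * q\<^sub>r * \<i>
      = w\<^sub>0 *\<^sub>R (cnj q * (of_vec p - (of_vec p\<^sub>r + \<i> * q\<^sub>r / of_real w\<^sub>0)))"
    using assms by (simp add: scaleR_conv_of_real field_simps)
  finally show ?thesis
    by simp
qed

lemma reference_center_complex:
  "reference_center w\<^sub>0 p\<^sub>r (to_mat q\<^sub>r) = to_vec (of_vec p\<^sub>r + \<i> * q\<^sub>r / of_real w\<^sub>0)"
proof -
  have "\<i> * q\<^sub>r / of_real w\<^sub>0 = (1 / w\<^sub>0) *\<^sub>R (\<i> * q\<^sub>r)"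
    by (simp add: scaleR_conv_of_real)
  then show ?thesis
    by (simp add: reference_center_def Q_half_pi_eq_to_mat e1_eq_to_vec to_mat_mult
        to_mat_vector_mult to_vec_add to_vec_scaleR)
qed

section \<open>Convergence to a tracking motion\<close>

text \<open>Convergence towards tracking is expressed by an exact tracking motion to which the
  vehicle is asymptotic in position and orientation. The sign of 1 + \<epsilon> means that v points
  along \<open>e1\<close>, and it makes V nonincreasing.\<close>

theorem proposition3:
  fixes \<omega>\<^sub>0 k\<^sub>P \<epsilon> :: real
    and v :: "real ^ 2"
    and p\<^sub>r p :: "real \<Rightarrow> real ^ 2"
    and Q\<^sub>r Q :: "real \<Rightarrow> real ^ 2 ^ 2"
    and \<omega> :: "real \<Rightarrow> real"
  assumes "\<omega>\<^sub>0 > 0" and "k\<^sub>P > 0"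
    and "1 + \<epsilon> > 0" and "v = (1 + \<epsilon>) *\<^sub>R e1"
    and "vehicle_motion e1 (\<lambda>_. \<omega>\<^sub>0) p\<^sub>r Q\<^sub>r"
    and "\<forall>t\<ge>0. \<omega> t = \<omega>\<^sub>0 + omega_P \<omega>\<^sub>0 k\<^sub>P (p\<^sub>r t) (Q\<^sub>r t) (p t) (Q t)"
    and "vehicle_motion v \<omega> p Q"
  shows "\<exists>p' Q' c.
      motion_tracking p\<^sub>r Q\<^sub>r p' Q' \<and>
      ((\<lambda>t. p t - p' t) \<longlongrightarrow> 0) at_top \<and>
      ((\<lambda>t. Q t - Q' t) \<longlongrightarrow> 0) at_top \<and>
      (\<omega> \<longlongrightarrow> \<omega>\<^sub>0) at_top \<and>
      vehicle_motion v (\<lambda>_. \<omega>\<^sub>0) p' Q' \<and>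
      (\<forall>t\<ge>0. reference_center \<omega>\<^sub>0 (p\<^sub>r t) (Q\<^sub>r t) = c \<and> norm (p' t - c) = norm v / \<omega>\<^sub>0)"
proof -
  define a where "a = 1 + \<epsilon>"
  have pos: "0 < \<omega>\<^sub>0" "0 < k\<^sub>P" "0 < a"
    using assms(1-3) by (simp_all add: a_def)
  have v: "v = to_vec (of_real a)"
    unfolding of_real_def to_vec_scaleR using assms(4) by (simp only: a_def e1_eq_to_vec)
  note R = vehicle_motion_complexD[OF assms(5)[unfolded e1_eq_to_vec]]
  note M = vehicle_motion_complexD[OF assms(7)[unfolded v]]
  define q\<^sub>r q where "q\<^sub>r t = of_mat (Q\<^sub>r t)" and "q t = of_mat (Q t)" for t
  define center where "center t = of_vec (p\<^sub>r t) + \<i> * q\<^sub>r t / of_real \<omega>\<^sub>0" for t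
  define c where "c = center 0"
  have Q\<^sub>r: "Q\<^sub>r t = to_mat (q\<^sub>r t)" and norm_q\<^sub>r: "norm (q\<^sub>r t) = 1"
    and dq\<^sub>r: "(q\<^sub>r has_vector_derivative \<omega>\<^sub>0 *\<^sub>R (q\<^sub>r t * \<i>)) (at t within {0..})"
    and dp\<^sub>r: "((\<lambda>t. of_vec (p\<^sub>r t)) has_vector_derivative q\<^sub>r t) (at t within {0..})"
    if "0 \<le> t" for t
    using R[OF that] unfolding q\<^sub>r_def by simp_all
  have Q: "Q t = to_mat (q t)" and norm_q: "norm (q t) = 1"
    and dq: "(q has_vector_derivative \<omega> t *\<^sub>R (q t * \<i>)) (at t within {0..})"
    and dp: "((\<lambda>t. of_vec (p t)) has_vector_derivative q t * of_real a) (at t within {0..})"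
    if "0 \<le> t" for t
    using M[OF that] unfolding q_def by simp_all
  have center: "center t = c" if "0 \<le> t" for t
    unfolding c_def
  proof (rule constant_half_line[OF _ that])
    fix t :: real assume t: "0 \<le> t"
    have "(center has_vector_derivative q\<^sub>r t + \<i> * (\<omega>\<^sub>0 *\<^sub>R (q\<^sub>r t * \<i>)) / of_real \<omega>\<^sub>0) (at t within {0..})"
      unfolding center_def
      by (intro has_vector_derivative_add dp\<^sub>r[OF t] has_vector_derivative_divide
          has_vector_derivative_mult_right dq\<^sub>r[OF t])
    then show "(center has_vector_derivative 0) (at t within {0..})"
      using pos by (simp add: scaleR_conv_of_real mult.left_commute[of \<i>])
  qed
  have w: "\<omega> t = \<omega>\<^sub>0 + k\<^sub>P * \<omega>\<^sub>0 * Re (cnj (q t) * (of_vec (p t) - c))" if "0 \<le> t" for t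
    using assms(6)[rule_format, OF that]
    unfolding Q[OF that] Q\<^sub>r[OF that] omega_P_complex[OF pos(1)]
      center_def[symmetric] center[OF that] .
  have dd: "((\<lambda>t. of_vec (p t) - c) has_vector_derivative q t * of_real a) (at t within {0..})"
    if "0 \<le> t" for t
    using has_vector_derivative_diff[OF dp[OF that] has_vector_derivative_const] by simp
  obtain g where norm_g: "norm g = 1"
    and q_lim: "((\<lambda>t. q t - g * cis (\<omega>\<^sub>0 * t)) \<longlongrightarrow> 0) at_top"
    and d_lim: "((\<lambda>t. of_vec (p t) - c - g * cis (\<omega>\<^sub>0 * t) * (- \<i> * of_real (a / \<omega>\<^sub>0))) \<longlongrightarrow> 0) at_top"
    and w_lim: "(\<omega> \<longlongrightarrow> \<omega>\<^sub>0) at_top"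
    using steering_convergence[OF pos norm_q dq dd w] by blast

  \<comment> \<open>The limit supplied by the convergence result, now taken as a motion in its own
    right: uniform rotation about \<open>c\<close> at distance a /
    \<open>\<omega>\<^sub>0\<close>.\<close>
  define q' where "q' t = g * cis (\<omega>\<^sub>0 * t)" for t
  define p' where "p' t = c + q' t * (- \<i> * of_real (a / \<omega>\<^sub>0))" for t
  have norm_q': "norm (q' t) = 1" for t
    by (simp add: q'_def norm_mult norm_g)
  have dq': "(q' has_vector_derivative \<omega>\<^sub>0 *\<^sub>R (q' t * \<i>)) (at t within S)" for t S
  proof -
    have "((\<lambda>t. cis (\<omega>\<^sub>0 * t)) has_derivative (\<lambda>h. (\<omega>\<^sub>0 * h) *\<^sub>R (\<i> * cis (\<omega>\<^sub>0 * t)))) (at t within S)"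
      by (rule has_derivative_cis) (auto intro!: derivative_eq_intros)
    then have "((\<lambda>t. cis (\<omega>\<^sub>0 * t)) has_vector_derivative \<omega>\<^sub>0 *\<^sub>R (\<i> * cis (\<omega>\<^sub>0 * t))) (at t within S)"
      by (simp add: has_vector_derivative_def mult.commute)
    from has_vector_derivative_mult_right[OF this, of g] show ?thesis
      by (simp add: q'_def[abs_def] ac_simps)
  qed
  have dp': "(p' has_vector_derivative q' t * of_real a) (at t within S)" for t S
  proof -
    have "(p' has_vector_derivative \<omega>\<^sub>0 *\<^sub>R (q' t * \<i>) * (- \<i> * of_real (a / \<omega>\<^sub>0))) (at t within S)"
      using has_vector_derivative_add[OF has_vector_derivative_const
          has_vector_derivative_mult_left[OF dq', of "- \<i> * of_real (a / \<omega>\<^sub>0)"], of c]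
      unfolding p'_def[abs_def] by (simp only: add_0_left)
    also have "\<omega>\<^sub>0 *\<^sub>R (q' t * \<i>) * (- \<i> * of_real (a / \<omega>\<^sub>0)) = q' t * of_real a"
      using pos by (simp add: scaleR_conv_of_real)
    finally show ?thesis .
  qed
  have rel: "cnj (q\<^sub>r t) * q' t = cnj (q\<^sub>r 0) * q' 0" if "0 \<le> t" for t
  proof (rule constant_half_line[OF _ that])
    fix t :: real assume t: "0 \<le> t"
    show "((\<lambda>t. cnj (q\<^sub>r t) * q' t) has_vector_derivative 0) (at t within {0..})"
      using has_vector_derivative_mult[OF
          bounded_linear.has_vector_derivative[OF bounded_linear_cnj dq\<^sub>r[OF t]] dq'[of t "{0..}"]]
      by (simp add: scaleR_conv_of_real algebra_simps)
  qed

  have "motion_tracking p\<^sub>r Q\<^sub>r (\<lambda>t. to_vec (p' t)) (\<lambda>t. to_mat (q' t))"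
    unfolding motion_tracking_def
  proof (intro exI allI impI conjI)
    fix t :: real assume t: "0 \<le> t"
    show "transpose (Q\<^sub>r t) ** to_mat (q' t) = to_mat (cnj (q\<^sub>r 0) * q' 0)"
      by (simp add: Q\<^sub>r[OF t] transpose_to_mat to_mat_mult rel[OF t])
    have "transpose (Q\<^sub>r t) *v (to_vec (p' t) - p\<^sub>r t) = to_vec (cnj (q\<^sub>r t) * (p' t - of_vec (p\<^sub>r t)))"
      by (simp add: Q\<^sub>r[OF t] transpose_to_mat to_vec_diff flip: to_mat_vector_mult)
    \<comment> \<open>The displacement is split at the center: the reference sees the center at the
      fixed point i / \<open>\<omega>\<^sub>0\<close>, and the vehicle's offset from the center
      turns with the constant relative heading.\<close>
    also have "cnj (q\<^sub>r t) * (p' t - of_vec (p\<^sub>r t))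
        = \<i> / of_real \<omega>\<^sub>0 * (cnj (q\<^sub>r t) * q\<^sub>r t) + (cnj (q\<^sub>r t) * q' t) * (- \<i> * of_real (a / \<omega>\<^sub>0))"
      unfolding p'_def center[OF t, symmetric] center_def by (simp add: algebra_simps)
    also have "cnj (q\<^sub>r t) * q\<^sub>r t = 1"
      using norm_q\<^sub>r[OF t] by (simp add: mult.commute flip: complex_norm_square)
    also note rel[OF t]
    finally show "transpose (Q\<^sub>r t) *v (to_vec (p' t) - p\<^sub>r t)
        = to_vec (\<i> / of_real \<omega>\<^sub>0 * 1 + (cnj (q\<^sub>r 0) * q' 0) * (- \<i> * of_real (a / \<omega>\<^sub>0)))" .
  qed
  moreover have "((\<lambda>t. p t - to_vec (p' t)) \<longlongrightarrow> 0) at_top"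
  proof -
    have "((\<lambda>t. of_vec (p t) - p' t) \<longlongrightarrow> 0) at_top"
      using d_lim by (simp add: p'_def q'_def algebra_simps)
    from bounded_linear.tendsto_zero[OF bounded_linear_to_vec this] show ?thesis
      by (simp add: to_vec_diff)
  qed
  moreover have "((\<lambda>t. Q t - to_mat (q' t)) \<longlongrightarrow> 0) at_top"
  \<comment> \<open>The complex form of \<open>Q t\<close> is available only for t \<ge> 0, so the
    two functions agree only eventually.\<close>
  proof (rule Lim_transform_eventually)
    show "((\<lambda>t. to_mat (q t - q' t)) \<longlongrightarrow> 0) at_top"
      using bounded_linear.tendsto_zero[OF bounded_linear_to_mat q_lim] by (simp add: q'_def)
    show "\<forall>\<^sub>F t in at_top. to_mat (q t - q' t) = Q t - to_mat (q' t)"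
      using eventually_ge_at_top[of 0]
      by eventually_elim
        (simp add: Q linear_diff[OF bounded_linear.linear[OF bounded_linear_to_mat]])
  qed
  moreover have "vehicle_motion v (\<lambda>_. \<omega>\<^sub>0) (\<lambda>t. to_vec (p' t)) (\<lambda>t. to_mat (q' t))"
    unfolding v by (rule vehicle_motion_complexI[OF norm_q' dq' dp'])
  moreover have "reference_center \<omega>\<^sub>0 (p\<^sub>r t) (Q\<^sub>r t) = to_vec c \<and> norm (to_vec (p' t) - to_vec c) = norm v / \<omega>\<^sub>0"
    if "0 \<le> t" for t
  proof
    show "reference_center \<omega>\<^sub>0 (p\<^sub>r t) (Q\<^sub>r t) = to_vec c"
      by (simp add: Q\<^sub>r[OF that] reference_center_complex flip: center[OF that] center_def)
    show "norm (to_vec (p' t) - to_vec c) = norm v / \<omega>\<^sub>0"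
      using pos by (simp add: p'_def v norm_to_vec norm_mult norm_divide norm_q' flip: to_vec_diff)
  qed
  ultimately show ?thesis
    using w_lim by blast
qed

end
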